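(* Let $n\geq 1$ be an integer and let $f\in \mathcal{U}_n$. Then $$\operatorname{Re}\left(\left(\frac{f(z)}{z}\right)^{\frac{n}{2}}\right)>\frac12\quad\text{for all } z\in\mathbb{D}.$$
   Context: $\mathbb{D}=\{z\in\mathbb{C}: |z|<1\}$. $\mathcal{A}$ is the family of functions $f$ analytic in $\mathbb{D}$ with $f(0)=0$ and $f'(0)=1$. $\mathcal{S}$ is the subclass of $\mathcal{A}$ consisting of univalent (injective) functions in $\mathbb{D}$. $\mathcal{U}$ is the subclass of those $f\in\mathcal{S}$ such that $$\left|\left(\frac{z}{f(z)}\right)^2 f'(z)-1\right|<1\quad\text{for all } z\in\mathbb{D},$$ where $z/f(z)$ is given its limit value $1$ at $z=0$. For an integer $n\ge 1$, $\mathcal{A}_n$ is the class of functions $f\in\mathcal{A}$ of the form $f(z)=z+a_{n+1}z^{n+1}+\cdots$ (i.e. the Taylor coefficients of $z^2,\dots,z^n$ vanish), and $\mathcal{U}_n=\mathcal{A}_n\cap\mathcal{U}$. For $f\in\mathcal{U}_n$ the function $f(z)/z$ (with value $1$ at $z=0$) is analytic and non-vanishing in $\mathbb{D}$, and $(f(z)/z)^{n/2}$ denotes the analytic branch $\exp\left(\frac n2 \log\frac{f(z)}{z}\right)$ on $\mathbb{D}$, where $\log\frac{f(z)}{z}$ is the analytic logarithm vanishing at $z=0$; so its value at $z=0$ is $1$. *)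

theory Defs
  imports "HOL-Complex_Analysis.Complex_Analysis"
begin

abbreviation unit_disc :: "complex set"
  where "unit_disc \<equiv> ball 0 1"

definition class_A :: "(complex \<Rightarrow> complex) set"
  where "class_A = {f. f holomorphic_on unit_disc \<and> f 0 = 0 \<and> deriv f 0 = 1}"

definition class_S :: "(complex \<Rightarrow> complex) set"
  where "class_S = {f \<in> class_A. inj_on f unit_disc}"

definition z_over :: "(complex \<Rightarrow> complex) \<Rightarrow> complex \<Rightarrow> complex"
  where "z_over f z = (if z = 0 then 1 else z / f z)"

definition over_z :: "(complex \<Rightarrow> complex) \<Rightarrow> complex \<Rightarrow> complex"
  where "over_z f z = (if z = 0 then 1 else f z / z)"

definition class_U :: "(complex \<Rightarrow> complex) set"
  where "class_U = {f \<in> class_S. \<forall>z\<in>unit_disc. cmod ((z_over f z)\<^sup>2 * deriv f z - 1) < 1}"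

definition taylor_coeff :: "(complex \<Rightarrow> complex) \<Rightarrow> nat \<Rightarrow> complex"
  where "taylor_coeff f k = (deriv ^^ k) f 0 / fact k"

definition class_An :: "nat \<Rightarrow> (complex \<Rightarrow> complex) set"
  where "class_An n = {f \<in> class_A. \<forall>k\<in>{2..n}. taylor_coeff f k = 0}"

definition class_Un :: "nat \<Rightarrow> (complex \<Rightarrow> complex) set"
  where "class_Un n = class_An n \<inter> class_U"

text \<open>
  An analytic logarithm \<open>L\<close> of \<open>g\<close> on the disc with \<open>L 0 = 0\<close>. If \<open>g\<close> is holomorphic and
  non-vanishing on the disc and \<open>g 0 = 1\<close>, it exists and its values on the disc are uniquely
  determined (\<open>is_disc_log_exists\<close>, \<open>is_disc_log_unique\<close> below).
\<close>

definition is_disc_log :: "(complex \<Rightarrow> complex) \<Rightarrow> (complex \<Rightarrow> complex) \<Rightarrow> bool"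
  where "is_disc_log g L \<longleftrightarrow>
    L holomorphic_on unit_disc \<and> L 0 = 0 \<and> (\<forall>z\<in>unit_disc. exp (L z) = g z)"

definition disc_log :: "(complex \<Rightarrow> complex) \<Rightarrow> complex \<Rightarrow> complex"
  where "disc_log g = (SOME L. is_disc_log g L)"

definition disc_power :: "(complex \<Rightarrow> complex) \<Rightarrow> complex \<Rightarrow> complex \<Rightarrow> complex"
  where "disc_power g a z = exp (a * disc_log g z)"

lemma is_disc_log_exists:
  assumes "g holomorphic_on unit_disc" "\<And>z. z \<in> unit_disc \<Longrightarrow> g z \<noteq> 0" "g 0 = 1"
  shows "\<exists>L. is_disc_log g L"
proof -
  obtain h where h: "h holomorphic_on unit_disc" "\<And>z. z \<in> unit_disc \<Longrightarrow> exp (h z) = g z"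
    using holomorphic_logarithm_exists[of unit_disc g 0] assms by auto
  have "exp (h 0) = 1" using h(2)[of 0] assms(3) by simp
  then have "is_disc_log g (\<lambda>z. h z - h 0)"
    unfolding is_disc_log_def using h by (auto intro!: holomorphic_intros simp: exp_diff)
  then show ?thesis by blast
qed

lemma is_disc_log_unique:
  assumes L: "is_disc_log g L" and M: "is_disc_log g M" and z: "z \<in> unit_disc"
  shows "L z = M z"
proof -
  define h where "h = (\<lambda>z. L z - M z)"
  have hol: "h holomorphic_on unit_disc"
    using L M by (auto simp: h_def is_disc_log_def intro!: holomorphic_intros)
  have exp1: "exp (h w) = 1" if "w \<in> unit_disc" for w
  proof -
    have "exp (L w) = exp (M w)" using L M that by (simp add: is_disc_log_def)
    then show ?thesis by (simp add: h_def exp_diff)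
  qed
  have "(h has_field_derivative 0) (at w within unit_disc)" if w: "w \<in> unit_disc" for w
  proof -
    have d: "(h has_field_derivative deriv h w) (at w)"
      using hol w holomorphic_derivI by blast
    have e: "((\<lambda>z. exp (h z)) has_field_derivative exp (h w) * deriv h w) (at w)"
      using d by (auto intro!: derivative_eq_intros)
    have "((\<lambda>z. exp (h z)) has_field_derivative 0) (at w)"
      by (rule has_field_derivative_transform_within_open[OF DERIV_const[of 1] _ w])
         (use exp1 in auto)
    with e have "deriv h w = 0" using DERIV_unique by fastforce
    with d show ?thesis using has_field_derivative_at_within by metis
  qed
  then obtain c where c: "\<And>w. w \<in> unit_disc \<Longrightarrow> h w = c"
    using has_field_derivative_zero_constant[of unit_disc h] by auto
  have "h 0 = 0" using L M by (simp add: h_def is_disc_log_def)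
  then have "h z = 0" using c[of 0] c[OF z] by simp
  then show ?thesis by (simp add: h_def)
qed

lemma over_z_regular:
  assumes "f \<in> class_S"
  shows "over_z f holomorphic_on unit_disc" "\<And>z. z \<in> unit_disc \<Longrightarrow> over_z f z \<noteq> 0"
proof -
  have f: "f holomorphic_on unit_disc" "f 0 = 0" "deriv f 0 = 1" "inj_on f unit_disc"
    using assms by (auto simp: class_S_def class_A_def)
  have "over_z f = (\<lambda>z. if z = 0 then deriv f 0 else (f z - f 0) / (z - 0))"
    using f by (auto simp: over_z_def)
  then show "over_z f holomorphic_on unit_disc"
    using pole_lemma_open[OF f(1), of 0] by simp
  show "over_z f z \<noteq> 0" if "z \<in> unit_disc" for z
    using inj_onD[OF f(4), of z 0] f(2) that by (auto simp: over_z_def)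
qed

lemma is_disc_log_disc_log:
  assumes "f \<in> class_S"
  shows "is_disc_log (over_z f) (disc_log (over_z f))"
  unfolding disc_log_def
proof (rule someI_ex[of "is_disc_log (over_z f)"], rule is_disc_log_exists)
  show "over_z f 0 = 1" by (simp add: over_z_def)
qed (use over_z_regular[OF assms] in simp_all)

end

theory Submission
  imports Defs
begin

text \<open>
  Let \<open>L = log (f z / z)\<close> and \<open>P = z / f = exp (- L)\<close>, so that the defining condition of the class
  reads \<open>|P - z P' - 1| < 1\<close>, and the claim is \<open>|P powr (n/2) - 1| < 1\<close>.
  If \<open>\<phi>\<close> vanishes to order \<open>n\<close> at \<open>0\<close> and \<open>|\<phi>|\<close> is maximal on a closed disc at \<open>z0\<close>,
  Jack's lemma gives \<open>z0 \<phi>'(z0) = K \<phi>(z0)\<close> with a real \<open>K \<ge> n\<close>.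
  For \<open>n = 1\<close> apply it to \<open>\<phi> = sqrt P - 1\<close>: if \<open>|\<phi>(z0)| \<ge> 1\<close> then
  \<open>|P - z P' - 1| = |\<phi>| |(2K - 1) \<phi> + (2K - 2)| \<ge> 1\<close> at \<open>z0\<close>.
  For \<open>n \<ge> 2\<close> apply it to \<open>\<phi> = P - 1\<close>: then \<open>P - z P' - 1 = (1 - K) \<phi>\<close> at \<open>z0\<close>, hence
  \<open>|P - 1| < 1 / (n - 1)\<close> on the disc, and the mean value inequality for \<open>u powr (n/2)\<close> yields
  \<open>|P powr (n/2) - 1| < (n / (n - 1)) powr (n/2) / 2 \<le> 1\<close>.
\<close>

section \<open>Zeros of order \<open>m\<close> and Jack's lemma\<close>

text \<open>Shifting the Taylor series by \<open>m\<close> places gives a series that still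
  converges on the whole ball, so the quotient is holomorphic there.\<close>

lemma holomorphic_factor_power:
  assumes F: "F holomorphic_on ball 0 r" and r: "r > 0"
    and 0: "\<And>k. k < m \<Longrightarrow> (deriv ^^ k) F 0 = 0"
  obtains g where "g holomorphic_on ball 0 r" "\<And>z. z \<in> ball 0 r \<Longrightarrow> F z = z ^ m * g z"
proof -
  define c where "c = (\<lambda>k. (deriv ^^ k) F 0 / fact k)"
  have sm: "(\<lambda>k. c k * w ^ k) sums F w" if "w \<in> ball 0 r" for w
    using holomorphic_power_series[OF F that] by (simp add: c_def)
  have cz: "c k = 0" if "k < m" for k using 0[OF that] by (simp add: c_def)
  define g where "g = (\<lambda>z. if z = 0 then c m else F z / z ^ m)"
  have "(\<lambda>k. c (k + m) * (w - 0) ^ k) sums g w" if w: "w \<in> ball 0 r" for w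
  proof (cases "w = 0")
    case True
    then show ?thesis using powser_sums_zero[of "\<lambda>k. c (k + m)"] by (simp add: g_def)
  next
    case False
    have "(\<lambda>k. c (k + m) * w ^ (k + m)) sums F w"
      using sm[OF w] sums_iff_shift[of "\<lambda>k. c k * w ^ k" m "F w"] cz by simp
    from sums_divide[OF this, of "w ^ m"] False show ?thesis
      by (simp add: g_def power_add)
  qed
  then have "g holomorphic_on ball 0 r" by (rule power_series_holomorphic)
  moreover have "F z = z ^ m * g z" if z: "z \<in> ball 0 r" for z
  proof (cases "z = 0")
    case True
    have "F 0 = c 0" using sums_unique2[OF powser_sums_zero[of c] sm[of 0]] r by simp
    then show ?thesis using True cz[of 0] by (cases m) (auto simp: g_def)
  qed (simp add: g_def)
  ultimately show ?thesis using that by blast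
qed

text \<open>Jack's lemma. In the coordinate \<open>s\<close> given by \<open>z = z0 * exp s\<close>, the function
  \<open>\<phi> z / z ^ n\<close>, normalised to be 1 at \<open>s = 0\<close>, has modulus at most 1 on \<open>Re s \<le> 0\<close>;
  so its derivative \<open>D\<close> at \<open>0\<close> satisfies \<open>Re (D * d) \<le> 0\<close> in the directions
  \<open>d = -1, \<i>, -\<i>\<close>.\<close>

lemma jack_lemma:
  fixes \<phi> :: "complex \<Rightarrow> complex"
  assumes h: "h holomorphic_on ball 0 r" and \<phi>: "\<And>z. z \<in> ball 0 r \<Longrightarrow> \<phi> z = z ^ n * h z"
    and z0: "z0 \<in> ball 0 r" "z0 \<noteq> 0" "\<phi> z0 \<noteq> 0"
    and max: "\<And>z. cmod z \<le> cmod z0 \<Longrightarrow> cmod (\<phi> z) \<le> cmod (\<phi> z0)"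
  obtains K where "K \<ge> real n" "z0 * deriv \<phi> z0 = of_real K * \<phi> z0"
proof -
  have sub: "cball 0 (cmod z0) \<subseteq> ball 0 r" using z0 by auto
  \<comment> \<open>As in Schwarz's lemma: on the boundary circle the modulus of
    \<open>z ^ n\<close> is constant, so the bound on \<open>\<phi>\<close> passes to
    \<open>h\<close>, and the maximum principle carries it inside.\<close>
  have hb: "cmod (h z) \<le> cmod (\<phi> z0) / cmod z0 ^ n" if "cmod z \<le> cmod z0" for z
  proof (rule maximum_modulus_frontier[where S = "cball 0 (cmod z0)" and f = h])
    show "h holomorphic_on interior (cball 0 (cmod z0))"
      by (rule holomorphic_on_subset[OF h]) (use sub interior_subset in blast)
    show "continuous_on (closure (cball 0 (cmod z0))) h"
      using continuous_on_subset[OF holomorphic_on_imp_continuous_on[OF h] sub] by simp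
    fix y :: complex assume "y \<in> frontier (cball 0 (cmod z0))"
    then have y: "cmod y = cmod z0" by (simp add: frontier_cball)
    then have "\<phi> y = y ^ n * h y" using z0 by (intro \<phi>) simp
    then have "cmod z0 ^ n * cmod (h y) \<le> cmod (\<phi> z0)"
      using max[of y] y by (simp add: norm_mult norm_power)
    then show "cmod (h y) \<le> cmod (\<phi> z0) / cmod z0 ^ n"
      using z0 by (simp add: field_simps)
  qed (use that in auto)
  have "\<phi> holomorphic_on ball 0 r"
    by (rule holomorphic_transform[of "\<lambda>z. z ^ n * h z"]) (use h \<phi> in \<open>auto intro!: holomorphic_intros\<close>)
  then have d\<phi>: "(\<phi> has_field_derivative deriv \<phi> z0) (at z0)"
    using z0 holomorphic_derivI by blast
  define D where "D = z0 * deriv \<phi> z0 / \<phi> z0 - of_nat n"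
  define G where "G = (\<lambda>s. \<phi> (z0 * exp s) * exp (- of_nat n * s) / \<phi> z0)"
  have dG: "(G has_field_derivative D) (at 0)"
  proof -
    have d1: "((\<lambda>s. z0 * exp s) has_field_derivative z0) (at 0)"
      by (auto intro!: derivative_eq_intros)
    have "((\<lambda>s. \<phi> (z0 * exp s)) has_field_derivative deriv \<phi> z0 * z0) (at 0)"
      using DERIV_chain2[OF _ d1, of \<phi> "deriv \<phi> z0"] d\<phi> by simp
    then show ?thesis unfolding G_def D_def
      by (auto intro!: derivative_eq_intros simp: field_simps z0)
  qed
  have G1: "cmod (G s) \<le> 1" if s: "Re s \<le> 0" for s
  proof -
    let ?z = "z0 * exp s"
    have z: "cmod ?z \<le> cmod z0" using s by (simp add: norm_mult mult_left_le)
    have "\<phi> ?z = ?z ^ n * h ?z" using z z0 by (intro \<phi>) simp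
    then have "G s = z0 ^ n * h ?z / \<phi> z0"
      by (simp add: G_def power_mult_distrib exp_of_nat_mult[symmetric] exp_minus)
    then have "cmod (G s) = cmod z0 ^ n * cmod (h ?z) / cmod (\<phi> z0)"
      by (simp add: norm_mult norm_divide norm_power)
    also have "\<dots> \<le> cmod z0 ^ n * (cmod (\<phi> z0) / cmod z0 ^ n) / cmod (\<phi> z0)"
      using hb[OF z] by (intro divide_right_mono mult_left_mono) auto
    also have "\<dots> = 1" using z0 by simp
    finally show ?thesis .
  qed
  \<comment> \<open>A positive derivative of \<open>Re G\<close> along \<open>d\<close> would lift
    it above \<open>G 0 = 1\<close> at a small step from \<open>0\<close>, which stays in the
    half-plane covered by \<open>G1\<close>.\<close>
  have dir: "Re (D * d) \<le> 0" if d: "Re d \<le> 0" for d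
  proof (rule ccontr)
    assume "\<not> Re (D * d) \<le> 0"
    moreover have "((\<lambda>t. Re (G (of_real t * d))) has_field_derivative Re (D * d)) (at 0)"
    proof -
      have "((\<lambda>t. of_real t * d) has_vector_derivative d) (at (0::real))"
        by (auto intro!: derivative_eq_intros)
      then have "((\<lambda>t. G (of_real t * d)) has_vector_derivative d * D) (at 0)"
        using field_vector_diff_chain_at[of "\<lambda>t. of_real t * d" d 0 G D] dG by (simp add: o_def)
      then show ?thesis
        unfolding has_real_derivative_iff_has_vector_derivative
        using bounded_linear.has_vector_derivative[OF bounded_linear_Re] by (metis mult.commute)
    qed
    ultimately obtain e where e: "e > 0" "\<And>k. k > 0 \<Longrightarrow> k < e \<Longrightarrow> Re (G 0) < Re (G (of_real k * d))"
      using DERIV_pos_inc_right[of "\<lambda>t. Re (G (of_real t * d))" "Re (D * d)" 0] by auto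
    have "G 0 = 1" using z0 by (simp add: G_def)
    then have "1 < Re (G (of_real (e/2) * d))" using e(2)[of "e/2"] e(1) by simp
    moreover have "cmod (G (of_real (e/2) * d)) \<le> 1"
      using e(1) d by (intro G1) (simp add: mult_nonneg_nonpos)
    ultimately show False using complex_Re_le_cmod order.strict_trans2 by (metis not_less)
  qed
  have "Im D = 0" "Re D \<ge> 0" using dir[of \<i>] dir[of "-\<i>"] dir[of "-1"] by auto
  then have "D = of_real (Re D)" by (simp add: complex_eq_iff)
  then have "z0 * deriv \<phi> z0 = of_real (Re D + n) * \<phi> z0"
    unfolding D_def using z0 by (simp add: field_simps)
  then show ?thesis using that[of "Re D + n"] \<open>Re D \<ge> 0\<close> by simp
qed

text \<open>Trades a given point \<open>z1\<close> for a maximum point on the closed disc through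
  it. That point is not \<open>0\<close>, because \<open>\<phi>\<close> vanishes there.\<close>

lemma jack_lemma_max:
  fixes \<phi> :: "complex \<Rightarrow> complex"
  assumes h: "h holomorphic_on ball 0 r" and \<phi>: "\<And>z. z \<in> ball 0 r \<Longrightarrow> \<phi> z = z ^ n * h z"
    and n: "n \<ge> 1" and z1: "z1 \<in> ball 0 r" "\<phi> z1 \<noteq> 0"
  obtains z0 K where "z0 \<in> ball 0 r" "cmod (\<phi> z1) \<le> cmod (\<phi> z0)" "K \<ge> real n"
    "z0 * deriv \<phi> z0 = of_real K * \<phi> z0"
proof -
  have sub: "cball 0 (cmod z1) \<subseteq> ball 0 r" using z1 by auto
  have "\<phi> holomorphic_on ball 0 r"
    by (rule holomorphic_transform[of "\<lambda>z. z ^ n * h z"]) (use h \<phi> in \<open>auto intro!: holomorphic_intros\<close>)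
  then have "continuous_on (cball 0 (cmod z1)) (\<lambda>z. cmod (\<phi> z))"
    using sub by (intro continuous_on_norm continuous_on_subset[OF holomorphic_on_imp_continuous_on])
  then obtain z0 where z0: "z0 \<in> cball 0 (cmod z1)"
    "\<And>z. z \<in> cball 0 (cmod z1) \<Longrightarrow> cmod (\<phi> z) \<le> cmod (\<phi> z0)"
    using continuous_attains_sup[of "cball 0 (cmod z1)" "\<lambda>z. cmod (\<phi> z)"] by auto
  have le: "cmod (\<phi> z1) \<le> cmod (\<phi> z0)" using z0 by simp
  have nz: "\<phi> z0 \<noteq> 0" using le z1 by auto
  have in0: "z0 \<in> ball 0 r" using z0 sub by blast
  have "z0 \<noteq> 0" using nz \<phi>[OF in0] n by auto
  from jack_lemma[OF h \<phi> in0 this nz] z0 le in0 that show ?thesis by fastforce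
qed

section \<open>Elementary estimates for inverses and powers\<close>

text \<open>The hypothesis squares to \<open>|u|^2 < 2 * Re u\<close>; dividing by
  \<open>|u|^2\<close> gives the half-plane.\<close>

lemma Re_inverse_gt_half:
  fixes u :: complex
  assumes "cmod (u - 1) < 1"
  shows "Re (inverse u) > 1 / 2"
proof -
  have "(Re u - 1)\<^sup>2 + (Im u)\<^sup>2 < 1"
    using assms by (simp add: cmod_def real_less_lsqrt)
  then have *: "(Re u)\<^sup>2 + (Im u)\<^sup>2 < 2 * Re u" by (simp add: power2_eq_square algebra_simps)
  have "u \<noteq> 0" using assms by auto
  then have "(Re u)\<^sup>2 + (Im u)\<^sup>2 > 0" by (simp add: complex_eq_iff sum_power2_gt_zero_iff)
  with * show ?thesis unfolding inverse_complex.sel by (simp add: field_simps)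
qed

text \<open>After squaring, the bound is 4, attained at \<open>n = 2\<close>. For
  \<open>n \<ge> 4\<close>, \<open>1 + x \<le> exp x\<close> with \<open>x = 1 / (n - 1)\<close>
  suffices, since \<open>n * x = 1 + x \<le> 4 / 3\<close>.\<close>

lemma half_power_bound:
  assumes "n \<ge> 2"
  shows "(real n / (real n - 1)) powr (real n / 2) \<le> 2"
proof -
  have "(real n / (real n - 1)) ^ n \<le> 4"
  proof (cases "n \<le> 3")
    case True
    then have "n = 2 \<or> n = 3" using assms by auto
    then show ?thesis by (auto simp: power_divide)
  next
    case False
    define x where "x = 1 / (real n - 1)"
    have x: "0 < x" "x \<le> 1 / 3" using False by (auto simp: x_def field_simps)
    have e1: "real n / (real n - 1) = 1 + x" using False by (simp add: x_def field_simps)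
    have "(1 + x) ^ n \<le> exp x ^ n" using x exp_ge_add_one_self[of x] by (intro power_mono) auto
    also have "\<dots> = exp (1 + x)"
      using False by (simp add: exp_of_nat_mult[symmetric] x_def field_simps)
    also have "\<dots> \<le> exp (4 / 3)" using x by simp
    also have "\<dots> \<le> 4"
    proof -
      \<comment> \<open>Cubing clears the fractional exponent; \<open>2.8 ^ 4\<close> is about 61.5,
        below 64.\<close>
      have "exp (4 / 3 :: real) ^ 3 = exp 1 ^ 4" by (simp flip: exp_of_nat_mult)
      also have "\<dots> \<le> 2.8 ^ 4" using e_less_272 by (intro power_mono) auto
      also have "\<dots> \<le> 4 ^ 3" by (simp add: power_divide)
      finally have "exp (4 / 3 :: real) ^ Suc 2 \<le> 4 ^ Suc 2" by simp
      then show ?thesis by (rule power_le_imp_le_base) simp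
    qed
    finally show ?thesis using e1 by simp
  qed
  moreover have "real n / (real n - 1) > 0" using assms by simp
  moreover from this have "((real n / (real n - 1)) powr (real n / 2)) ^ 2 = (real n / (real n - 1)) ^ n"
    by (simp only: power2_eq_square flip: powr_add powr_realpow) simp
  ultimately have "((real n / (real n - 1)) powr (real n / 2)) ^ 2 \<le> 2 ^ 2" by simp
  then show ?thesis by (rule power2_le_imp_le) simp
qed

lemma norm_powr_minus_one:
  fixes u :: complex
  assumes n: "n \<ge> 2" and u: "cmod (u - 1) < 1 / (real n - 1)"
  shows "cmod (u powr (of_nat n / 2) - 1) < 1"
proof -
  define r where "r = 1 / (real n - 1)"
  define a where "a = real n / 2"
  have r: "r > 0" "r \<le> 1" "1 + r = real n / (real n - 1)" using n by (auto simp: r_def field_simps)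
  have a: "a \<ge> 1" using n by (simp add: a_def)
  have b: "cmod (u powr of_real a - 1 powr of_real a) \<le> (a * (1 + r) powr (a - 1)) * cmod (u - 1)"
  proof (rule field_differentiable_bound[where S = "ball 1 r"])
    fix z :: complex assume z: "z \<in> ball 1 r"
    \<comment> \<open>As \<open>r \<le> 1\<close>, the ball lies in the right half-plane, off the
      branch cut of \<open>powr\<close>.\<close>
    have z1: "cmod (1 - z) < 1" using z r by (auto simp: dist_norm)
    have "Re (1 - z) < 1" using z1 complex_Re_le_cmod[of "1 - z"] by linarith
    then have nn: "z \<notin> \<real>\<^sub>\<le>\<^sub>0" by (auto simp: complex_nonpos_Reals_iff)
    then show "((\<lambda>z. z powr of_real a) has_field_derivative of_real a * z powr (of_real a - 1)) (at z within ball 1 r)"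
      by (auto intro!: derivative_eq_intros)
    have "cmod z \<le> 1 + r" using z norm_triangle_ineq[of 1 "z - 1"] by (simp add: dist_norm norm_minus_commute)
    then have "cmod z powr (a - 1) \<le> (1 + r) powr (a - 1)" using a by (intro powr_mono2) auto
    then show "cmod (of_real a * z powr (of_real a - 1)) \<le> a * (1 + r) powr (a - 1)"
      using a norm_powr_real_powr'[of "of_real a - 1" z] by (simp add: norm_mult)
  qed (use u r in \<open>auto simp: r_def dist_norm norm_minus_commute\<close>)
  also have "\<dots> < (a * (1 + r) powr (a - 1)) * r"
    using u a r by (intro mult_strict_left_mono) (auto simp: r_def)
  also have "\<dots> = (1 + r) powr a / 2"
  proof -
    have "(1 + r) powr a = (1 + r) * (1 + r) powr (a - 1)"
      using r by (simp add: powr_diff)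
    \<comment> \<open>This identity makes the mean value bound collapse to
      \<open>(1 + r) powr a / 2\<close>.\<close>
    moreover have "1 + r = 2 * a * r" using n by (simp add: r_def a_def field_simps)
    ultimately show ?thesis by simp
  qed
  also have "\<dots> \<le> 1" using half_power_bound[OF n] r by (simp add: a_def)
  finally show ?thesis by (simp add: a_def)
qed

section \<open>The class U in terms of a logarithm of \<open>f z / z\<close>\<close>

context
  fixes f L :: "complex \<Rightarrow> complex"
  assumes U: "f \<in> class_U" and L: "is_disc_log (over_z f) L"
begin

lemma L_holomorphic: "L holomorphic_on unit_disc"
  and L_0: "L 0 = 0"
  and exp_L: "z \<in> unit_disc \<Longrightarrow> exp (L z) = over_z f z"
  using L by (auto simp: is_disc_log_def)

lemma f_eq: "z \<in> unit_disc \<Longrightarrow> f z = z * exp (L z)"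
  using U by (auto simp: exp_L over_z_def class_U_def class_S_def class_A_def)

lemma L_deriv: "z \<in> unit_disc \<Longrightarrow> (L has_field_derivative deriv L z) (at z)"
  using L_holomorphic holomorphic_derivI by blast

text \<open>With \<open>f = z * exp L\<close>, one factor \<open>exp L\<close> of the derivative
  cancels against the two factors \<open>exp (- L)\<close> of the square.\<close>

lemma class_U_log:
  assumes z: "z \<in> unit_disc"
  shows "cmod (exp (- L z) * (1 + z * deriv L z) - 1) < 1"
proof -
  have "((\<lambda>z. z * exp (L z)) has_field_derivative exp (L z) * (1 + z * deriv L z)) (at z)"
    using L_deriv[OF z] by (auto intro!: derivative_eq_intros simp: algebra_simps)
  then have "(f has_field_derivative exp (L z) * (1 + z * deriv L z)) (at z)"
    by (rule has_field_derivative_transform_within_open[of _ _ _ unit_disc]) (use z f_eq in auto)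
  then have df: "deriv f z = exp (L z) * (1 + z * deriv L z)" by (rule DERIV_imp_deriv)
  have "z_over f z = exp (- L z)"
    using z f_eq[OF z] by (auto simp: z_over_def L_0 exp_minus inverse_eq_divide)
  then have "(z_over f z)\<^sup>2 * deriv f z = exp (- L z) * (1 + z * deriv L z)"
    by (simp add: df power2_eq_square exp_minus)
  moreover have "cmod ((z_over f z)\<^sup>2 * deriv f z - 1) < 1" using U z by (simp add: class_U_def)
  ultimately show ?thesis by simp
qed

lemma norm_sqrt_minus_one:
  assumes z1: "z1 \<in> unit_disc"
  shows "cmod (exp (- L z1 / 2) - 1) < 1"
proof (rule ccontr)
  assume neg: "\<not> cmod (exp (- L z1 / 2) - 1) < 1"
  define \<phi> where "\<phi> = (\<lambda>z. exp (- L z / 2) - 1)"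
  have hol: "\<phi> holomorphic_on unit_disc"
    unfolding \<phi>_def by (intro holomorphic_intros L_holomorphic) auto
  obtain h where h: "h holomorphic_on unit_disc" "\<And>z. z \<in> unit_disc \<Longrightarrow> \<phi> z = z ^ 1 * h z"
    using holomorphic_factor_power[OF hol, of 1] by (auto simp: \<phi>_def L_0)
  have "\<phi> z1 \<noteq> 0" using neg by (auto simp: \<phi>_def)
  then obtain z0 K where z0: "z0 \<in> unit_disc" and le: "cmod (\<phi> z1) \<le> cmod (\<phi> z0)"
    and K: "K \<ge> 1" "z0 * deriv \<phi> z0 = of_real K * \<phi> z0"
    using jack_lemma_max[OF h _ z1] by auto
  define q where "q = \<phi> z0"
  have q1: "cmod q \<ge> 1" using neg le by (simp add: q_def \<phi>_def)
  have e: "exp (- L z0 / 2) = 1 + q" by (simp add: q_def \<phi>_def)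
  have "(\<phi> has_field_derivative - (exp (- L z0 / 2) * deriv L z0 / 2)) (at z0)"
    unfolding \<phi>_def using L_deriv[OF z0] by (auto intro!: derivative_eq_intros)
  then have dphi: "deriv \<phi> z0 = - ((1 + q) * deriv L z0 / 2)" unfolding e by (rule DERIV_imp_deriv)
  have 1: "(1 + q) * (z0 * deriv L z0) = - 2 * of_real K * q"
  proof -
    have "(1 + q) * (z0 * deriv L z0) = - 2 * (z0 * deriv \<phi> z0)"
      unfolding dphi by simp
    then show ?thesis by (simp add: K(2) q_def)
  qed
  have "exp (- L z0) = (1 + q)\<^sup>2" unfolding e[symmetric] by (simp flip: exp_double)
  then have "exp (- L z0) * (1 + z0 * deriv L z0) - 1
      = (1 + q)\<^sup>2 + (1 + q) * ((1 + q) * (z0 * deriv L z0)) - 1"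
    by (simp add: power2_eq_square algebra_simps)
  also have "\<dots> = - q * (of_real (2 * K - 1) * q + of_real (2 * K - 2))"
    unfolding 1 by (simp add: power2_eq_square algebra_simps)
  finally have "cmod q * cmod (of_real (2 * K - 1) * q + of_real (2 * K - 2)) < 1"
    using class_U_log[OF z0] by (simp only: norm_mult norm_minus_cancel)
  moreover have "1 \<le> cmod (of_real (2 * K - 1) * q + of_real (2 * K - 2))"
  proof -
    \<comment> \<open>Reverse triangle inequality:
      \<open>(2 * K - 1) * |q| - (2 * K - 2) \<ge> 1\<close>, where \<open>K \<ge> 1\<close> keeps
      both coefficients nonnegative.\<close>
    have "(2 * K - 1) * 1 \<le> (2 * K - 1) * cmod q" using K q1 by (intro mult_left_mono) auto
    then have "1 \<le> cmod (of_real (2 * K - 1) * q) - cmod (of_real (2 * K - 2))"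
      unfolding norm_mult norm_of_real using K(1) by (simp add: algebra_simps)
    also have "\<dots> \<le> cmod (of_real (2 * K - 1) * q + of_real (2 * K - 2))" by (rule norm_diff_ineq)
    finally show ?thesis .
  qed
  ultimately show False using q1 mult_mono[of 1 "cmod q" 1] by fastforce
qed

lemma norm_z_over_minus_one:
  assumes n: "n \<ge> 2" and fn: "f \<in> class_Un n" and z1: "z1 \<in> unit_disc"
  shows "cmod (exp (- L z1) - 1) < 1 / (real n - 1)"
proof (cases "exp (- L z1) - 1 = 0")
  case True
  then show ?thesis using n by simp
next
  case False
  have fA: "f \<in> class_A" and tc: "\<And>k. k \<in> {2..n} \<Longrightarrow> (deriv ^^ k) f 0 = 0"
    using fn by (auto simp: class_Un_def class_An_def taylor_coeff_def)
  then have f: "f holomorphic_on unit_disc" "f 0 = 0" "deriv f 0 = 1" by (auto simp: class_A_def)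
  \<comment> \<open>The order is \<open>Suc n\<close> because one factor \<open>z\<close> is lost in
    passing from \<open>f z - z\<close> to \<open>exp (L z) - 1\<close>.\<close>
  obtain g where g: "g holomorphic_on unit_disc" "\<And>z. z \<in> unit_disc \<Longrightarrow> f z - z = z ^ Suc n * g z"
  proof (rule holomorphic_factor_power)
    show "(\<lambda>z. f z - z) holomorphic_on unit_disc" by (intro holomorphic_intros f)
    fix k assume k: "k < Suc n"
    have "(deriv ^^ k) (\<lambda>z. f z - z) 0 = (deriv ^^ k) f 0 - (deriv ^^ k) (\<lambda>z. z) 0"
      by (rule higher_deriv_diff[OF f(1)]) (auto intro: holomorphic_intros)
    also have "\<dots> = 0"
      using k f tc[of k] by (cases "k = 0 \<or> k = 1") auto
    finally show "(deriv ^^ k) (\<lambda>z. f z - z) 0 = 0" .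
  qed auto
  define \<phi> where "\<phi> = (\<lambda>z. exp (- L z) - 1)"
  have h: "(\<lambda>z. - g z * exp (- L z)) holomorphic_on unit_disc"
    by (intro holomorphic_intros g L_holomorphic)
  have \<phi>: "\<phi> z = z ^ n * (- g z * exp (- L z))" if z: "z \<in> unit_disc" for z
  proof (cases "z = 0")
    case True
    then show ?thesis using n by (simp add: \<phi>_def L_0)
  next
    case False
    then have "exp (L z) - 1 = z ^ n * g z"
    proof -
      have "z * (exp (L z) - 1) = z * (z ^ n * g z)"
        using g(2)[OF z] f_eq[OF z] by (simp add: algebra_simps)
      then show ?thesis using False by simp
    qed
    then have "z ^ n * (- g z * exp (- L z)) = - (exp (L z) - 1) * exp (- L z)" by simp
    then show ?thesis by (simp add: \<phi>_def exp_minus field_simps)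
  qed
  obtain z0 K where z0: "z0 \<in> unit_disc" and le: "cmod (\<phi> z1) \<le> cmod (\<phi> z0)"
    and K: "K \<ge> real n" "z0 * deriv \<phi> z0 = of_real K * \<phi> z0"
    using jack_lemma_max[OF h \<phi> _ z1] False n by (auto simp: \<phi>_def)
  have "(\<phi> has_field_derivative - (exp (- L z0) * deriv L z0)) (at z0)"
    unfolding \<phi>_def using L_deriv[OF z0] by (auto intro!: derivative_eq_intros)
  then have "deriv \<phi> z0 = - (exp (- L z0) * deriv L z0)" by (rule DERIV_imp_deriv)
  then have "exp (- L z0) * (1 + z0 * deriv L z0) - 1 = \<phi> z0 - of_real K * \<phi> z0"
    unfolding K(2)[symmetric] by (simp add: \<phi>_def algebra_simps)
  also have "\<dots> = of_real (1 - K) * \<phi> z0" by (simp add: algebra_simps)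
  finally have "\<bar>1 - K\<bar> * cmod (\<phi> z0) < 1"
    using class_U_log[OF z0] by (simp only: norm_mult norm_of_real)
  \<comment> \<open>Here \<open>K \<ge> n\<close> gives
    \<open>|1 - K| = K - 1 \<ge> n - 1\<close>.\<close>
  moreover have "(real n - 1) * cmod (\<phi> z1) \<le> \<bar>1 - K\<bar> * cmod (\<phi> z0)"
    using K n le by (intro mult_mono) auto
  ultimately have "(real n - 1) * cmod (\<phi> z1) < 1" by linarith
  then show ?thesis using n by (simp add: \<phi>_def field_simps)
qed

lemma norm_half_power_minus_one:
  assumes n: "n \<ge> 2" and fn: "f \<in> class_Un n" and z: "z \<in> unit_disc"
  shows "cmod (exp (- (of_nat n / 2 * L z)) - 1) < 1"
proof -
  have nn: "exp (- L w) \<notin> \<real>\<^sub>\<le>\<^sub>0" if "w \<in> unit_disc" for w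
  proof -
    have "cmod (exp (- L w) - 1) < 1 / (real n - 1)" by (rule norm_z_over_minus_one[OF n fn that])
    also have "\<dots> \<le> 1" using n by simp
    finally have "Re (1 - exp (- L w)) < 1"
      using complex_Re_le_cmod[of "1 - exp (- L w)"] by (simp only: norm_minus_commute)
    then show ?thesis by (auto simp: complex_nonpos_Reals_iff)
  qed
  \<comment> \<open>\<open>exp (- L w)\<close> avoids the cut of \<open>Ln\<close>, so uniqueness of
    the disc logarithm identifies \<open>L\<close> with this principal branch, and
    \<open>powr\<close> computes the required power.\<close>
  have "is_disc_log (over_z f) (\<lambda>w. - Ln (exp (- L w)))"
    unfolding is_disc_log_def using nn
    by (auto intro!: holomorphic_intros L_holomorphic simp: L_0 exp_minus[of "Ln _"] simp flip: exp_L)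
      (simp add: exp_minus)
  from is_disc_log_unique[OF L this z] have Lz: "L z = - Ln (exp (- L z))" .
  have "exp (- L z) powr (of_nat n / 2) = exp (of_nat n / 2 * Ln (exp (- L z)))"
    by (simp add: powr_def)
  also have "\<dots> = exp (- (of_nat n / 2 * L z))" by (subst (2) Lz) simp
  finally show ?thesis
    using norm_powr_minus_one[OF n norm_z_over_minus_one[OF n fn z]] by simp
qed

end

theorem theorem1:
  fixes n :: nat and f :: "complex \<Rightarrow> complex"
  assumes "n \<ge> 1"
    and "f \<in> class_Un n"
  shows "\<forall>z\<in>unit_disc. Re (disc_power (over_z f) (of_nat n / 2) z) > 1 / 2"
proof
  fix z :: complex assume z: "z \<in> unit_disc"
  have U: "f \<in> class_U" using assms(2) by (simp add: class_Un_def)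
  then have L: "is_disc_log (over_z f) (disc_log (over_z f))"
    by (intro is_disc_log_disc_log) (simp add: class_U_def)
  have "cmod (exp (- (of_nat n / 2 * disc_log (over_z f) z)) - 1) < 1"
  proof (cases "n = 1")
    case True
    then show ?thesis using norm_sqrt_minus_one[OF U L z] by simp
  next
    case False
    then show ?thesis using norm_half_power_minus_one[OF U L _ assms(2) z] assms(1) by simp
  qed
  \<comment> \<open>The power in the claim is the inverse of the exponential just bounded.\<close>
  from Re_inverse_gt_half[OF this]
  show "Re (disc_power (over_z f) (of_nat n / 2) z) > 1 / 2"
    by (simp add: disc_power_def exp_minus)
qed

end
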